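(* Let $q$, $s$ and $k$ be positive integers such that $q\geq 2$, $s\geq 3$ and $k\geq 1$. For every $j=1,\ldots,s$, $$K_{q}^{\mathcal{R}}(2k+1,s,(k+1)s-j)\leq q^{ks+j}-q^{k(s-2)+j}(q^k-1).$$
   Context: NRT poset: for positive integers $m,s$, the NRT poset $[m\cdot s]$ is the set $\{1,\ldots,ms\}$ partitioned into $m$ blocks $B_i=\{is+1,\ldots,(i+1)s\}$, $i=0,\ldots,m-1$, where each block is a chain $is+1\preceq is+2\preceq\cdots\preceq (i+1)s$ and elements of different blocks are incomparable. An ideal is a subset $I$ such that $b\in I$ and $a\preceq b$ imply $a\in I$; $\langle A\rangle$ denotes the smallest ideal containing $A$. NRT distance: for $x,y\in\mathbb{Z}_q^{ms}$, $d_{\mathcal{R}}(x,y)=|\langle\{i: x_i\neq y_i\}\rangle|$, the ideal being taken in $[m\cdot s]$. Covering codes: a subset $C\subseteq \mathbb{Z}_q^{ms}$ is an $R$-covering of the NRT space $\mathbb{Z}_q^{ms}$ if for every $x\in\mathbb{Z}_q^{ms}$ there is $c\in C$ with $d_{\mathcal{R}}(x,c)\leq R$. $K_q^{\mathcal{R}}(m,s,R)$ is the smallest cardinality of an $R$-covering of the NRT space $\mathbb{Z}_q^{ms}$ (with respect to the NRT poset $[m\cdot s]$). *)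

theory Defs
  imports Complex_Main "HOL-Library.FuncSet"
begin

definition nrt_block :: "nat \<Rightarrow> nat \<Rightarrow> nat set" where
  "nrt_block s i = {i * s + 1..(i + 1) * s}"

definition nrt_le :: "nat \<Rightarrow> nat \<Rightarrow> nat \<Rightarrow> nat \<Rightarrow> bool" where
  "nrt_le m s a b \<longleftrightarrow> (\<exists>i<m. a \<in> nrt_block s i \<and> b \<in> nrt_block s i \<and> a \<le> b)"

definition nrt_ideal :: "nat \<Rightarrow> nat \<Rightarrow> nat set \<Rightarrow> bool" where
  "nrt_ideal m s I \<longleftrightarrow> I \<subseteq> {1..m * s} \<and> (\<forall>a b. b \<in> I \<longrightarrow> nrt_le m s a b \<longrightarrow> a \<in> I)"

definition nrt_ideal_gen :: "nat \<Rightarrow> nat \<Rightarrow> nat set \<Rightarrow> nat set" where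
  "nrt_ideal_gen m s A = \<Inter>{I. nrt_ideal m s I \<and> A \<subseteq> I}"

(* Only equality of letters matters for the distance, so Z_q is represented by the
   residues 0, ..., q - 1.  Words are extensional functions on the coordinates 1, ..., m * s,
   so that HOL equality of words is equality of vectors and the space is finite. *)
definition nrt_space :: "nat \<Rightarrow> nat \<Rightarrow> nat \<Rightarrow> (nat \<Rightarrow> nat) set" where
  "nrt_space q m s = ({1..m * s} \<rightarrow>\<^sub>E {0..<q})"

definition nrt_dist :: "nat \<Rightarrow> nat \<Rightarrow> (nat \<Rightarrow> nat) \<Rightarrow> (nat \<Rightarrow> nat) \<Rightarrow> nat" where
  "nrt_dist m s x y = card (nrt_ideal_gen m s {i \<in> {1..m * s}. x i \<noteq> y i})"

definition nrt_covering :: "nat \<Rightarrow> nat \<Rightarrow> nat \<Rightarrow> nat \<Rightarrow> (nat \<Rightarrow> nat) set \<Rightarrow> bool" where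
  "nrt_covering q m s R C \<longleftrightarrow>
     C \<subseteq> nrt_space q m s \<and> (\<forall>x \<in> nrt_space q m s. \<exists>c \<in> C. nrt_dist m s x c \<le> R)"

(* The whole space is always an R-covering and all coverings are finite, so this minimum
   exists and is a genuine cardinality. *)
definition nrt_K :: "nat \<Rightarrow> nat \<Rightarrow> nat \<Rightarrow> nat \<Rightarrow> nat" where
  "nrt_K q m s R = (LEAST n. \<exists>C. nrt_covering q m s R C \<and> card C = n)"

end

theory Submission
  imports Defs
begin

text \<open>Since ideals are generated downwards, a ball of radius \<open>(k + 1) * s - j\<close> consists of the words
  whose common upper segments with the centre, summed over the blocks, have total length at least
  \<open>k * s + j\<close>. Let the code run through all values on suitable upper segments of total length
  \<open>k * s + j - 2\<close>, chosen so that three blocks have a next letter left below these segments. On those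
  three letters it suffices to agree in two places, which is a covering of \<open>{0..<q} ^ 3\<close> with Hamming
  radius 1. Such a covering has \<open>1 + (q - 1)\<^sup>2\<close> elements: two of three letters are both zero or both
  nonzero, so the zero word together with a Latin square on the nonzero letters is enough.\<close>

text \<open>The bottom segments of length \<open>h i\<close> in the blocks \<open>i\<close> together
  form an ideal. It contains every coordinate where the words differ, hence also the ideal generated
  by these coordinates.\<close>

lemma nrt_dist_le_sum:
  assumes h: "\<And>i. i < m \<Longrightarrow> h i \<le> s"
    and diff: "\<And>i p. i < m \<Longrightarrow> p \<in> {1..s} \<Longrightarrow> x (i * s + p) \<noteq> y (i * s + p) \<Longrightarrow> p \<le> h i"
  shows "nrt_dist m s x y \<le> (\<Sum>i<m. h i)"
proof -
  define I where "I = (\<Union>i<m. {i * s + 1..i * s + h i})"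
  \<comment> \<open>\<open>nrt_le\<close> only says that some block contains both elements. The
    quotient of \<open>b - 1\<close> by \<open>s\<close> identifies it with the block through which
    \<open>b\<close> lies in \<open>I\<close>.\<close>
  have block_unique: "i = i'" if "b \<in> {i * s + 1..i * s + s}" "b \<in> {i' * s + 1..i' * s + s}"
    for b i i' :: nat
  proof -
    have "b - 1 = i * s + (b - 1 - i * s)" "b - 1 - i * s < s"
         "b - 1 = i' * s + (b - 1 - i' * s)" "b - 1 - i' * s < s"
      using that by auto
    then have "(b - 1) div s = i" "(b - 1) div s = i'"
      by (metis add.right_neutral div_less div_mult_self3 not_less_zero)+
    then show ?thesis by simp
  qed
  have sub: "{i * s + 1..i * s + h i} \<subseteq> {i * s + 1..i * s + s}" if "i < m" for i
    using h[OF that] by auto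
  have le: "i * s + s \<le> m * s" if "i < m" for i
    using mult_le_mono1[of "Suc i" m s] that by simp
  have "nrt_ideal m s I"
    unfolding nrt_ideal_def
  proof (intro conjI allI impI)
    show "I \<subseteq> {1..m * s}"
      using sub le unfolding I_def by fastforce
    fix a b assume "b \<in> I" and "nrt_le m s a b"
    then obtain i i' where i: "i < m" "b \<in> {i * s + 1..i * s + h i}"
      and i': "i' < m" "a \<in> {i' * s + 1..i' * s + s}" "b \<in> {i' * s + 1..i' * s + s}" "a \<le> b"
      unfolding I_def nrt_le_def nrt_block_def by (auto simp: add.commute)
    have "i = i'" using block_unique i i' sub by blast
    then show "a \<in> I" using i i' unfolding I_def by auto
  qed
  moreover have "{i \<in> {1..m * s}. x i \<noteq> y i} \<subseteq> I"
  proof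
    fix n assume n: "n \<in> {i \<in> {1..m * s}. x i \<noteq> y i}"
    define i p where "i = (n - 1) div s" and "p = (n - 1) mod s + 1"
    have "s > 0" using n by (cases s) auto
    have n_eq: "n = i * s + p" using n unfolding i_def p_def by simp
    have "p \<in> {1..s}" using \<open>s > 0\<close> unfolding p_def by (simp add: Suc_leI)
    moreover have "i < m"
      using n \<open>s > 0\<close> unfolding i_def by (intro less_mult_imp_div_less) auto
    ultimately have "p \<le> h i" using diff n n_eq by auto
    then have "n \<in> {i * s + 1..i * s + h i}" using \<open>p \<in> {1..s}\<close> n_eq by simp
    then show "n \<in> I" using \<open>i < m\<close> unfolding I_def by blast
  qed
  ultimately have "nrt_ideal_gen m s {i \<in> {1..m * s}. x i \<noteq> y i} \<subseteq> I"
    unfolding nrt_ideal_gen_def by blast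
  moreover have "finite I" unfolding I_def by simp
  ultimately have "nrt_dist m s x y \<le> card I"
    unfolding nrt_dist_def by (intro card_mono)
  also have "\<dots> \<le> (\<Sum>i<m. card {i * s + 1..i * s + h i})"
    unfolding I_def by (intro card_UN_le) simp
  finally show ?thesis by simp
qed

lemma hamming_covering_3_1:
  fixes q :: nat
  assumes "q \<ge> 2"
  obtains T where "finite T" "card T \<le> 1 + (q - 1)\<^sup>2" "T \<subseteq> {0..<q} \<times> {0..<q} \<times> {0..<q}"
    "\<And>a b c. a < q \<Longrightarrow> b < q \<Longrightarrow> c < q \<Longrightarrow>
      \<exists>(u, v, w) \<in> T. u = a \<and> v = b \<or> u = a \<and> w = c \<or> v = b \<and> w = c"
proof
  define r where "r = q - 1"
  have r: "r > 0" "q = Suc r" using assms unfolding r_def by auto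
  \<comment> \<open>The Latin square is the addition table of the integers mod \<open>r\<close>,
    shifted by 1 so that its letters are the nonzero ones.\<close>
  define f where "f = (\<lambda>(a, b). (a + 1, b + 1, (a + b) mod r + 1))"
  define T where "T = insert (0, 0, 0) (f ` ({..<r} \<times> {..<r}))"
  show "finite T" unfolding T_def by simp
  have "card (f ` ({..<r} \<times> {..<r})) \<le> r\<^sup>2"
    using card_image_le[of "{..<r} \<times> {..<r}" f] by (simp add: power2_eq_square)
  then show "card T \<le> 1 + (q - 1)\<^sup>2"
    unfolding T_def r_def[symmetric] by (intro order.trans[OF card_insert_le_m1]) auto
  show "T \<subseteq> {0..<q} \<times> {0..<q} \<times> {0..<q}"
    using r unfolding T_def f_def by auto
  have T0: "(0, 0, 0) \<in> T" unfolding T_def by simp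
  have T1: "(Suc a, Suc b, Suc ((a + b) mod r)) \<in> T" if "a < r" "b < r" for a b
    using that unfolding T_def f_def by force
  \<comment> \<open>Each row of the addition table takes every value; by commutativity so does each
    column. This settles the cases that prescribe the third letter.\<close>
  have solve: "\<exists>b<r. (a + b) mod r = c" if "a < r" "c < r" for a c
  proof (intro exI conjI)
    show "(c + (r - a)) mod r < r" using r by simp
    have "(a + (c + (r - a)) mod r) mod r = (a + (c + (r - a))) mod r"
      by (simp add: mod_add_right_eq)
    also have "a + (c + (r - a)) = c + r" using that by simp
    finally show "(a + (c + (r - a)) mod r) mod r = c" using that by simp
  qed
  fix a b c assume "a < q" "b < q" "c < q"
  then consider "a = 0" "b = 0" | "a = 0" "c = 0" | "b = 0" "c = 0"
    | a' b' where "a = Suc a'" "b = Suc b'" "a' < r" "b' < r"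
    | a' c' where "a = Suc a'" "c = Suc c'" "a' < r" "c' < r"
    | b' c' where "b = Suc b'" "c = Suc c'" "b' < r" "c' < r"
    using r by (cases a; cases b; cases c) auto
  then show "\<exists>(u, v, w) \<in> T. u = a \<and> v = b \<or> u = a \<and> w = c \<or> v = b \<and> w = c"
  proof cases
    case 1
    then show ?thesis using T0 by (intro bexI[of _ "(0, 0, 0)"]) auto
  next
    case 2
    then show ?thesis using T0 by (intro bexI[of _ "(0, 0, 0)"]) auto
  next
    case 3
    then show ?thesis using T0 by (intro bexI[of _ "(0, 0, 0)"]) auto
  next
    case (4 a' b')
    then show ?thesis using T1[of a' b'] by force
  next
    case (5 a' c')
    then obtain b' where "b' < r" "(a' + b') mod r = c'" using solve by blast
    then show ?thesis using T1[of a' b'] 5 by force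
  next
    case (6 b' c')
    then obtain a' where "a' < r" "(b' + a') mod r = c'" using solve by blast
    then show ?thesis using T1[of a' b'] 6 by (force simp: add.commute)
  qed
qed

lemma nrt_K_le:
  assumes "nrt_covering q m s R C"
  shows "nrt_K q m s R \<le> card C"
  unfolding nrt_K_def using assms by (intro Least_le) blast

text \<open>Fixing \<open>k * s + j\<close> upper letters would give a covering of size
  \<open>q ^ (k * s + j)\<close>. Trading two of them for three letters constrained to
  \<open>T\<close> replaces a factor of \<open>q\<close> squared by
  \<open>1 + (q - 1)\<^sup>2\<close>.\<close>

lemma nrt_K_le_hamming:
  fixes q s k j :: nat
  assumes q: "q \<ge> 2" and k: "k \<ge> 1" and j: "j \<in> {1..s}"
  shows "nrt_K q (2 * k + 1) s ((k + 1) * s - j) \<le> q ^ (k * s + j - 2) * (1 + (q - 1)\<^sup>2)"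
proof -
  obtain T where T: "finite T" "card T \<le> 1 + (q - 1)\<^sup>2" "T \<subseteq> {0..<q} \<times> {0..<q} \<times> {0..<q}"
    and T_cover: "\<And>a b c. a < q \<Longrightarrow> b < q \<Longrightarrow> c < q \<Longrightarrow>
      \<exists>(u, v, w) \<in> T. u = a \<and> v = b \<or> u = a \<and> w = c \<or> v = b \<and> w = c"
    by (rule hamming_covering_3_1[OF q]) blast
  define m where "m = 2 * k + 1"
  obtain k' where k': "k = Suc k'" using k by (cases k) auto
  \<comment> \<open>Upper segments: all but the bottom letter of block 0, the top
    \<open>j - 1\<close> letters of block 1, none of block 2, and all of the blocks 3 to
    \<open>k + 1\<close>. The lengths \<open>s - 1\<close>, \<open>j - 1\<close>, 0 and
    \<open>k' * s\<close> add up to \<open>k * s + j - 2\<close>.\<close>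
  define P where "P = {2..s} \<union> {2 * s - j + 2..2 * s} \<union> {3 * s + 1..3 * s + k' * s}"
  \<comment> \<open>The letters \<open>u\<close>, \<open>v\<close>, \<open>w\<close> sit directly
    below the segments of blocks 0, 1 and 2; in block 2 the segment is empty, so this is the top
    coordinate \<open>3 * s\<close>. All other coordinates get the default 0.\<close>
  define enc where "enc = (\<lambda>(f, u, v, w). \<lambda>i\<in>{1..m * s}. if i \<in> P then f i
    else if i = 1 then u else if i = 2 * s - j + 1 then v else if i = 3 * s then w else (0::nat))"
  define C where "C = enc ` ((P \<rightarrow>\<^sub>E {0..<q}) \<times> T)"
  have finP: "finite P" unfolding P_def by simp
  have "card P \<le> card {2..s} + card {2 * s - j + 2..2 * s} + card {3 * s + 1..3 * s + k' * s}"
    unfolding P_def by (intro order.trans[OF card_Un_le] add_mono card_Un_le order.refl)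
  also have "\<dots> = k * s + j - 2" using j k' by simp
  finally have cardP: "card P \<le> k * s + j - 2" .
  have "card C \<le> card ((P \<rightarrow>\<^sub>E {0..<q}) \<times> T)"
    unfolding C_def using finP T by (intro card_image_le finite_cartesian_product finite_PiE) auto
  also have "\<dots> = q ^ card P * card T"
    using finP by (simp add: card_cartesian_product card_PiE)
  also have "\<dots> \<le> q ^ (k * s + j - 2) * (1 + (q - 1)\<^sup>2)"
    using cardP T q by (intro mult_mono power_increasing) auto
  finally have cardC: "card C \<le> q ^ (k * s + j - 2) * (1 + (q - 1)\<^sup>2)" .
  have m_s: "m * s = 3 * s + 2 * (k' * s)" unfolding m_def k' by (simp add: algebra_simps)
  have "nrt_covering q m s ((k + 1) * s - j) C"
    unfolding nrt_covering_def
  proof (intro conjI ballI)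
    show "C \<subseteq> nrt_space q m s"
      using T(3) q unfolding C_def nrt_space_def enc_def by (fastforce simp: PiE_iff)
    fix x assume x: "x \<in> nrt_space q m s"
    have x_lt: "x i < q" if "i \<in> {1..m * s}" for i
      using x that unfolding nrt_space_def by (auto simp: PiE_iff)
    have P_sub: "P \<subseteq> {1..m * s}" using j unfolding P_def m_s by auto
    have pos: "1 \<in> {1..m * s}" "2 * s - j + 1 \<in> {1..m * s}" "3 * s \<in> {1..m * s}"
      using j unfolding m_s by auto
    obtain u v w where uvw: "(u, v, w) \<in> T" and agree: "u = x 1 \<and> v = x (2 * s - j + 1)
        \<or> u = x 1 \<and> w = x (3 * s) \<or> v = x (2 * s - j + 1) \<and> w = x (3 * s)"
      using T_cover[OF x_lt x_lt x_lt, OF pos] by blast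
    define c where "c = enc (restrict x P, u, v, w)"
    have "restrict x P \<in> P \<rightarrow>\<^sub>E {0..<q}" using x_lt P_sub by auto
    then have "c \<in> C" unfolding c_def C_def using uvw by blast
    have c_P: "c i = x i" if "i \<in> P" for i
      using that P_sub unfolding c_def enc_def by auto
    have c_1: "c 1 = u" using pos j unfolding c_def enc_def P_def by auto
    have c_2: "c (2 * s - j + 1) = v" using pos j unfolding c_def enc_def P_def by auto
    have c_3: "c (3 * s) = w" using pos j unfolding c_def enc_def P_def by auto
    \<comment> \<open>Three blocks carrying a letter of \<open>T\<close>, then \<open>k - 1\<close>
      blocks fixed by \<open>P\<close>, then \<open>k - 1\<close> blocks where nothing is
      controlled.\<close>
    have split3: "(\<Sum>i<m. g i) = g 0 + g 1 + g 2 + (\<Sum>i\<in>{3..<k+2}. g i) + (\<Sum>i\<in>{k+2..<m}. g i)"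
      for g :: "nat \<Rightarrow> nat"
    proof -
      have "(\<Sum>i<m. g i) = sum g {0..<3} + sum g {3..<k+2} + sum g {k+2..<m}"
        using k sum.atLeastLessThan_concat[of 0 3 "k + 2" g] sum.atLeastLessThan_concat[of 0 "k + 2" m g]
        unfolding m_def lessThan_atLeast0 by linarith
      then show ?thesis by (simp add: numeral_3_eq_3 numeral_2_eq_2)
    qed
    \<comment> \<open>\<open>a\<close>, \<open>b\<close>, \<open>d\<close> bound the heights of
      disagreement in blocks 0, 1, 2. Below the segments these are at most 1,
      \<open>s - j + 1\<close> and \<open>s\<close>; each may drop by one if the letter of
      \<open>T\<close> there agrees.\<close>
    have dist: "nrt_dist m s x c \<le> (k + 1) * s - j"
      if abd: "a + b + d = 2 * s - j" "a \<le> 1" "b \<le> s - j + 1" "d \<le> s"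
        and a: "a = 0 \<Longrightarrow> x 1 = c 1"
        and b: "b \<le> s - j \<Longrightarrow> x (2 * s - j + 1) = c (2 * s - j + 1)" "s - j \<le> b"
        and d: "d < s \<Longrightarrow> x (3 * s) = c (3 * s)" "s - 1 \<le> d" for a b d
    proof -
      define h where "h = (\<lambda>i. if i = 0 then a else if i = 1 then b else if i = 2 then d
        else if i < k + 2 then 0 else s)"
      have "nrt_dist m s x c \<le> (\<Sum>i<m. h i)"
      proof (rule nrt_dist_le_sum)
        show "h i \<le> s" for i using abd j unfolding h_def by auto
        fix i p assume i: "i < m" and p: "p \<in> {1..s}" and ne: "x (i * s + p) \<noteq> c (i * s + p)"
        have nP: "i * s + p \<notin> P" using ne c_P by metis
        consider "i = 0" | "i = 1" | "i = 2" | "3 \<le> i" "i < k + 2" | "k + 2 \<le> i" "3 \<le> i"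
          using k by linarith
        then show "p \<le> h i"
        proof cases
          case 1
          then have "p = 1" using nP p unfolding P_def by auto
          then show ?thesis using a ne 1 unfolding h_def by (cases "a = 0") auto
        next
          case 2
          then have "p \<le> s - j + 1" using nP p j unfolding P_def by auto
          moreover have "p \<noteq> s - j + 1" if "b \<le> s - j"
          proof
            assume "p = s - j + 1"
            then have "i * s + p = 2 * s - j + 1" using 2 j by auto
            then show False using ne b that by simp
          qed
          ultimately show ?thesis using 2 b unfolding h_def by (cases "b \<le> s - j") auto
        next
          case 3
          then have "i * s + p = 3 * s" if "p = s" using that by simp
          then have "p \<noteq> s" if "d < s" using ne d that by metis
          then show ?thesis using 3 d p unfolding h_def by (cases "d < s") auto
        next
          case 4
          \<comment> \<open>These blocks lie wholly inside \<open>P\<close>, so no difference can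
            occur in them.\<close>
          then have "3 * s \<le> i * s" "i * s + s \<le> (k + 2) * s"
            using mult_le_mono1[of "Suc i" "k + 2" s] by auto
          moreover have "(k + 2) * s = 3 * s + k' * s" unfolding k' by (simp add: algebra_simps)
          ultimately have "3 * s + 1 \<le> i * s + p" "i * s + p \<le> 3 * s + k' * s"
            using p unfolding atLeastAtMost_iff by linarith+
          then have "i * s + p \<in> P" unfolding P_def by simp
          then show ?thesis using nP by simp
        next
          case 5
          then show ?thesis using p unfolding h_def by auto
        qed
      qed
      also have "\<dots> = 2 * s - j + k' * s"
        unfolding split3 using abd k' by (simp add: h_def m_def)
      also have "\<dots> = (k + 1) * s - j" using j k' by simp
      finally show ?thesis .
    qed
    \<comment> \<open>Two agreeing letters lower the total \<open>2 * s - j + 2\<close> of the three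
      maximal heights to \<open>2 * s - j\<close>; the cases differ in which block keeps its maximal
      height.\<close>
    from agree have "nrt_dist m s x c \<le> (k + 1) * s - j"
    proof (elim disjE conjE)
      assume "u = x 1" "v = x (2 * s - j + 1)"
      then show ?thesis using dist[of 0 "s - j" s] c_1 c_2 j by simp
    next
      assume "u = x 1" "w = x (3 * s)"
      moreover have "0 + (s - j + 1) + (s - 1) = 2 * s - j" using j by auto
      ultimately show ?thesis using dist[of 0 "s - j + 1" "s - 1"] c_1 c_3 by simp
    next
      assume "v = x (2 * s - j + 1)" "w = x (3 * s)"
      moreover have "1 + (s - j) + (s - 1) = 2 * s - j" using j by auto
      ultimately show ?thesis using dist[of 1 "s - j" "s - 1"] c_2 c_3 by simp
    qed
    with \<open>c \<in> C\<close> show "\<exists>c\<in>C. nrt_dist m s x c \<le> (k + 1) * s - j" by blast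
  qed
  then show ?thesis using nrt_K_le cardC unfolding m_def by (meson order.trans)
qed

theorem theorem10:
  fixes q s k j :: nat
  assumes "q \<ge> 2" and "s \<ge> 3" and "k \<ge> 1" and "j \<in> {1..s}"
  shows "int (nrt_K q (2 * k + 1) s ((k + 1) * s - j))
           \<le> int q ^ (k * s + j) - int q ^ (k * (s - 2) + j) * (int q ^ k - 1)"
proof -
  define Q where "Q = int q"
  have Q: "Q \<ge> 2" using assms unfolding Q_def by simp
  obtain k' where k': "k = Suc k'" using assms by (cases k) auto
  obtain s' where s': "s = s' + 2" using assms by (metis add.commute le_Suc_ex numeral_3_eq_3
    numeral_2_eq_2 Suc_leD)
  \<comment> \<open>Exposes the common factor with exponent \<open>k * (s - 2) + j\<close>, which is
    then divided out of the desired inequality.\<close>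
  have e1: "k * s + j - 2 = (k * (s - 2) + j) + 2 * k'" "k * s + j = (k * (s - 2) + j) + 2 * k' + 2"
    unfolding k' s' by (simp_all add: algebra_simps)
  \<comment> \<open>As \<open>1 + (Q - 1)\<^sup>2\<close> equals
    \<open>Q\<^sup>2 - (2 * Q - 2)\<close>, the reduced inequality says that
    \<open>Q ^ k - 1\<close> is at most \<open>Q ^ (2 * k') * (2 * Q - 2)\<close>. This follows from
    \<open>k \<le> 2 * k' + 1\<close> and \<open>Q \<le> 2 * Q - 2\<close>.\<close>
  have "Q ^ k - 1 \<le> Q ^ (2 * k' + 1)"
    using power_increasing[of k "2 * k' + 1" Q] Q k' by linarith
  also have "\<dots> \<le> Q ^ (2 * k') * (2 * Q - 2)"
    using Q by (simp add: mult.commute)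
  finally have "Q ^ (2 * k') * (1 + (Q - 1)\<^sup>2) \<le> Q ^ (2 * k' + 2) - (Q ^ k - 1)"
    by (simp add: power2_eq_square algebra_simps)
  then have "Q ^ (k * (s - 2) + j) * (Q ^ (2 * k') * (1 + (Q - 1)\<^sup>2))
      \<le> Q ^ (k * (s - 2) + j) * (Q ^ (2 * k' + 2) - (Q ^ k - 1))"
    using Q by (intro mult_left_mono) auto
  then have "Q ^ (k * s + j - 2) * (1 + (Q - 1)\<^sup>2)
      \<le> Q ^ (k * s + j) - Q ^ (k * (s - 2) + j) * (Q ^ k - 1)"
    unfolding e1(1) unfolding e1(2) power_add right_diff_distrib mult.assoc .
  moreover have "int (nrt_K q (2 * k + 1) s ((k + 1) * s - j))
      \<le> int (q ^ (k * s + j - 2) * (1 + (q - 1)\<^sup>2))"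
    using nrt_K_le_hamming assms by (intro of_nat_mono) blast
  moreover have "int (q ^ (k * s + j - 2) * (1 + (q - 1)\<^sup>2)) = Q ^ (k * s + j - 2) * (1 + (Q - 1)\<^sup>2)"
    using assms unfolding Q_def by (simp add: distrib_left)
  ultimately show ?thesis unfolding Q_def by linarith
qed

end
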